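(* Let $(X,\pi)$ be a holomorphic Poisson manifold and let $\pi_R$ and $\pi_I$ be the real and imaginary parts of $\pi$, i.e. $\pi=\pi_R+i\pi_I$ with $\pi_R,\pi_I\in\Gamma(\wedge^2TX)$. Then the symplectic foliations of the real Poisson structures $\pi_R$ and $\pi_I$ coincide, and their leaves are exactly the holomorphic symplectic leaves of $\pi$.
   Context: A holomorphic Poisson structure on a complex manifold $X$ is a bivector field $\pi\in\Gamma(\wedge^2T^{1,0}X)$ with $\bar\partial\pi=0$ and $[\pi,\pi]=0$; its real and imaginary parts $\pi_R,\pi_I$ are real Poisson bivector fields. For a bivector field $P$, $\langle\beta,P^\sharp\alpha\rangle=P(\alpha,\beta)$. The symplectic foliation of a real Poisson structure $P$ is the (singular) foliation integrating the distribution $P^\sharp(T^*X)\subset TX$. The holomorphic symplectic leaves of $\pi$ are the leaves of the (singular) holomorphic foliation given by $\pi^\sharp((T^{1,0}X)^* )\subset T^{1,0}X$; equivalently, identifying $T^{1,0}X$ with $TX$ by taking real parts, the leaves of the real distribution $\{\mathrm{Re}(v):v\in\pi^\sharp((T^{1,0}X)^* )\}$. *)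

theory Defs
  imports "HOL-Analysis.Analysis"
begin

section \<open>Smooth and holomorphic maps on open sets\<close>

primrec Ck_on :: "nat \<Rightarrow> 'v::real_normed_vector set \<Rightarrow> ('v \<Rightarrow> 'w::real_normed_vector) \<Rightarrow> bool" where
  "Ck_on 0 S f \<longleftrightarrow> continuous_on S f"
| "Ck_on (Suc k) S f \<longleftrightarrow>
     (\<forall>x\<in>S. f differentiable (at x)) \<and>
     (\<forall>v. Ck_on k S (\<lambda>x. frechet_derivative f (at x) v))"

definition smooth_on :: "'v::real_normed_vector set \<Rightarrow> ('v \<Rightarrow> 'w::real_normed_vector) \<Rightarrow> bool" where
  "smooth_on S f \<longleftrightarrow> (\<forall>k. Ck_on k S f)"

definition diffeo_on :: "'v::real_normed_vector set \<Rightarrow> ('v \<Rightarrow> 'v) \<Rightarrow> bool" where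
  "diffeo_on S f \<longleftrightarrow> open S \<and> open (f ` S) \<and> smooth_on S f \<and>
     (\<exists>g. smooth_on (f ` S) g \<and> (\<forall>x\<in>S. g (f x) = x))"

definition holo_on :: "(complex^'n::finite) set \<Rightarrow> (complex^'n \<Rightarrow> complex) \<Rightarrow> bool" where
  "holo_on S f \<longleftrightarrow>
     (\<forall>x\<in>S. \<exists>D. (f has_derivative D) (at x) \<and> (\<forall>v. D (\<i> *s v) = \<i> * D v))"

section \<open>Complex manifolds\<close>

type_synonym ('a, 'n) chart = "'a set \<times> ('a \<Rightarrow> complex^'n)"

definition is_chart :: "'a topology \<Rightarrow> ('a, 'n::finite) chart \<Rightarrow> bool" where
  "is_chart X c \<longleftrightarrow> openin X (fst c) \<and> open (snd c ` fst c) \<and>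
     homeomorphic_map (subtopology X (fst c)) (top_of_set (snd c ` fst c)) (snd c)"

definition transition :: "('a, 'n) chart \<Rightarrow> ('a, 'n) chart \<Rightarrow> complex^'n \<Rightarrow> complex^'n" where
  "transition c c' = snd c' \<circ> inv_into (fst c) (snd c)"

definition complex_manifold :: "'a topology \<Rightarrow> ('a, 'n::finite) chart set \<Rightarrow> bool" where
  "complex_manifold X A \<longleftrightarrow>
     Hausdorff_space X \<and> second_countable X \<and>
     (\<forall>c\<in>A. is_chart X c) \<and> (\<Union>c\<in>A. fst c) = topspace X \<and>
     (\<forall>c\<in>A. \<forall>c'\<in>A. \<forall>i. holo_on (snd c ` (fst c \<inter> fst c')) (\<lambda>x. transition c c' x $ i))"

section \<open>Covectors and bivectors on the model space\<close>

text \<open>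
  In a chart, every real tangent space is identified with \<^typ>\<open>complex^'n\<close>, the complex structure
  being \<open>v \<mapsto> \<i> *s v\<close>. With \<open>'k = real\<close> the type below is the real cotangent space; with
  \<open>'k = complex\<close> it is the complexified one, consisting of the real-linear complex-valued
  functionals. A bivector \<open>P\<close> is the alternating \<open>'k\<close>-bilinear form \<open>(\<alpha>, \<beta>) \<mapsto> P(\<alpha>, \<beta>)\<close> on covectors.
\<close>

type_synonym ('n, 'k) covec = "(complex^'n) \<Rightarrow>\<^sub>L 'k"

type_synonym ('n, 'k) bivec = "('n, 'k) covec \<Rightarrow> ('n, 'k) covec \<Rightarrow> 'k"

definition is_bivec :: "('n::finite, 'k::real_normed_field) bivec \<Rightarrow> bool" where
  "is_bivec P \<longleftrightarrow>
     (\<forall>\<alpha> \<alpha>' \<beta>. P (\<alpha> + \<alpha>') \<beta> = P \<alpha> \<beta> + P \<alpha>' \<beta>) \<and>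
     (\<forall>c \<alpha> \<beta>. P (blinfun_mult_right c o\<^sub>L \<alpha>) \<beta> = c * P \<alpha> \<beta>) \<and>
     (\<forall>\<alpha> \<beta>. P \<beta> \<alpha> = - P \<alpha> \<beta>)"

definition sharp :: "('n::finite, real) bivec \<Rightarrow> ('n, real) covec \<Rightarrow> complex^'n" where
  "sharp P \<alpha> = (THE v. \<forall>\<beta>. blinfun_apply \<beta> v = P \<alpha> \<beta>)"

text \<open>The pair \<open>(u, w)\<close> stands for the complex tangent vector \<open>u + \<i> w\<close>, where \<open>u\<close> and \<open>w\<close> are real.\<close>

type_synonym 'n ctangent = "(complex^'n) \<times> (complex^'n)"

definition cpair :: "('n::finite, complex) covec \<Rightarrow> 'n ctangent \<Rightarrow> complex" where
  "cpair \<alpha> Z = blinfun_apply \<alpha> (fst Z) + \<i> * blinfun_apply \<alpha> (snd Z)"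

definition re_tangent :: "'n ctangent \<Rightarrow> complex^'n" where
  "re_tangent Z = fst Z"

definition csharp :: "('n::finite, complex) bivec \<Rightarrow> ('n, complex) covec \<Rightarrow> 'n ctangent" where
  "csharp P \<alpha> = (THE Z. \<forall>\<beta>. cpair \<beta> Z = P \<alpha> \<beta>)"

text \<open>
  \<open>T10\<close> is the \<open>\<i>\<close>-eigenspace of the complex structure on the complexified tangent space. Its dual is
  identified with the complex-linear covectors, that is, those that vanish on the conjugate of \<open>T10\<close>.
\<close>

definition T10 :: "'n::finite ctangent set" where
  "T10 = {(u, w). (\<i> *s u, \<i> *s w) = (- w, u)}"

definition T10_dual :: "('n::finite, complex) covec set" where
  "T10_dual = {\<alpha>. \<forall>v. blinfun_apply \<alpha> (\<i> *s v) = \<i> * blinfun_apply \<alpha> v}"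

definition wedge :: "'n::finite ctangent \<Rightarrow> 'n ctangent \<Rightarrow> ('n, complex) bivec" where
  "wedge Z W \<alpha> \<beta> = cpair \<alpha> Z * cpair \<beta> W - cpair \<alpha> W * cpair \<beta> Z"

definition is_bivec20 :: "('n::finite, complex) bivec \<Rightarrow> bool" where
  "is_bivec20 P \<longleftrightarrow>
     (\<exists>(m::nat) Z W. (\<forall>k<m. Z k \<in> T10 \<and> W k \<in> T10) \<and>
        (\<forall>\<alpha> \<beta>. P \<alpha> \<beta> = (\<Sum>k<m. wedge (Z k) (W k) \<alpha> \<beta>)))"

definition re_covec :: "('n::finite, complex) covec \<Rightarrow> ('n, real) covec" where
  "re_covec \<alpha> = Blinfun Re o\<^sub>L \<alpha>"

definition im_covec :: "('n::finite, complex) covec \<Rightarrow> ('n, real) covec" where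
  "im_covec \<alpha> = Blinfun Im o\<^sub>L \<alpha>"

text \<open>The inclusion of real bivectors into complex ones, by complex-bilinear extension.\<close>

definition complexify :: "('n::finite, real) bivec \<Rightarrow> ('n, complex) bivec" where
  "complexify P \<alpha> \<beta> = Complex
     (P (re_covec \<alpha>) (re_covec \<beta>) - P (im_covec \<alpha>) (im_covec \<beta>))
     (P (re_covec \<alpha>) (im_covec \<beta>) + P (im_covec \<alpha>) (re_covec \<beta>))"

section \<open>Bivector fields and holomorphic Poisson structures\<close>

text \<open>
  A bivector field is the family of its local representatives in the charts of the atlas; they
  transform by pulling back covectors along the differential of the coordinate change. Only the
  values at points \<open>x \<in> snd c ` fst c\<close> for charts \<open>c\<close> of the atlas are meaningful.
\<close>

type_synonym ('a, 'n, 'k) bivec_field = "('a, 'n) chart \<Rightarrow> complex^'n \<Rightarrow> ('n, 'k) bivec"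

definition bivector_field ::
    "('a, 'n::finite) chart set \<Rightarrow> ('a, 'n, 'k::real_normed_field) bivec_field \<Rightarrow> bool" where
  "bivector_field A P \<longleftrightarrow>
     (\<forall>c\<in>A. \<forall>x\<in>snd c ` fst c. is_bivec (P c x)) \<and>
     (\<forall>c\<in>A. \<forall>\<alpha> \<beta>. smooth_on (snd c ` fst c) (\<lambda>x. P c x \<alpha> \<beta>)) \<and>
     (\<forall>c\<in>A. \<forall>c'\<in>A. \<forall>p\<in>fst c \<inter> fst c'. \<forall>\<alpha> \<beta>.
        let D = Blinfun (frechet_derivative (transition c c') (at (snd c p)))
        in P c' (snd c' p) \<alpha> \<beta> = P c (snd c p) (\<alpha> o\<^sub>L D) (\<beta> o\<^sub>L D))"

definition dir_deriv :: "(complex^'n::finite \<Rightarrow> complex) \<Rightarrow> complex^'n \<Rightarrow> 'n ctangent \<Rightarrow> complex" where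
  "dir_deriv f x Z = frechet_derivative f (at x) (fst Z) + \<i> * frechet_derivative f (at x) (snd Z)"

text \<open>
  The components of the Schouten bracket of two bivector fields on an open subset of the model space,
  evaluated on constant covectors. Its diagonal \<open>[P,P](df,dg,dh)\<close> is twice the Jacobiator of the
  bracket \<open>{f,g} = P(df,dg)\<close>; other authors use the opposite overall sign.
\<close>

definition schouten ::
    "(complex^'n::finite \<Rightarrow> ('n, complex) bivec) \<Rightarrow> (complex^'n \<Rightarrow> ('n, complex) bivec) \<Rightarrow> complex^'n
      \<Rightarrow> ('n, complex) covec \<Rightarrow> ('n, complex) covec \<Rightarrow> ('n, complex) covec \<Rightarrow> complex" where
  "schouten P Q x \<alpha> \<beta> \<gamma> =
     (let T = (\<lambda>P Q \<alpha> \<beta> \<gamma>. dir_deriv (\<lambda>y. Q y \<beta> \<gamma>) x (csharp (P x) \<alpha>))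
      in (T P Q \<alpha> \<beta> \<gamma> + T P Q \<beta> \<gamma> \<alpha> + T P Q \<gamma> \<alpha> \<beta>)
       + (T Q P \<alpha> \<beta> \<gamma> + T Q P \<beta> \<gamma> \<alpha> + T Q P \<gamma> \<alpha> \<beta>))"

text \<open>
  The last but one condition is \<open>\<partial>\<close>-bar closedness: in a holomorphic chart the constant covectors in
  \<open>T10_dual\<close> are the complex linear combinations of the \<open>dz\<^sub>i\<close>, so the coefficients of the
  field in the holomorphic frame \<open>\<partial>\<^sub>i \<and> \<partial>\<^sub>j\<close> are required to be holomorphic.
\<close>

definition holomorphic_poisson ::
    "('a, 'n::finite) chart set \<Rightarrow> ('a, 'n, complex) bivec_field \<Rightarrow> bool" where
  "holomorphic_poisson A \<pi> \<longleftrightarrow>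
     bivector_field A \<pi> \<and>
     (\<forall>c\<in>A. \<forall>x\<in>snd c ` fst c. is_bivec20 (\<pi> c x)) \<and>
     (\<forall>c\<in>A. \<forall>\<alpha>\<in>T10_dual. \<forall>\<beta>\<in>T10_dual. holo_on (snd c ` fst c) (\<lambda>x. \<pi> c x \<alpha> \<beta>)) \<and>
     (\<forall>c\<in>A. \<forall>x\<in>snd c ` fst c. \<forall>\<alpha> \<beta> \<gamma>. schouten (\<pi> c) (\<pi> c) x \<alpha> \<beta> \<gamma> = 0)"

section \<open>Distributions and their foliations\<close>

type_synonym ('a, 'n) distribution = "('a, 'n) chart \<Rightarrow> complex^'n \<Rightarrow> (complex^'n) set"

text \<open>
  \<open>integral_manifold X A \<Delta> L\<close>: the topology \<open>L\<close> makes the set \<open>topspace L\<close> an immersed submanifold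
  of \<open>X\<close> whose tangent spaces are given by \<open>\<Delta>\<close>. An immersed submanifold is a subset with a
  (possibly finer than induced) topology in which every point has an open neighbourhood \<open>U\<close> that is
  an embedded submanifold, carrying the induced topology; its smooth structure is determined by the
  topology. Here \<open>U\<close> is cut out, inside a chart, by a smooth slice chart \<open>\<psi>\<close> with values in a real
  linear subspace \<open>S\<close>.
\<close>

definition integral_manifold ::
    "'a topology \<Rightarrow> ('a, 'n::finite) chart set \<Rightarrow> ('a, 'n) distribution \<Rightarrow> 'a topology \<Rightarrow> bool" where
  "integral_manifold X A \<Delta> L \<longleftrightarrow>
     topspace L \<subseteq> topspace X \<and> second_countable L \<and>
     (\<forall>p\<in>topspace L. \<exists>U. p \<in> U \<and> openin L U \<and> subtopology L U = subtopology X U \<and>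
        (\<exists>c\<in>A. \<exists>G \<psi> S. U \<subseteq> fst c \<and> G \<subseteq> snd c ` fst c \<and> diffeo_on G \<psi> \<and> subspace S \<and>
           snd c ` U = {x\<in>G. \<psi> x \<in> S} \<and>
           (\<forall>x\<in>snd c ` U. {v. frechet_derivative \<psi> (at x) v \<in> S} = \<Delta> c x)))"

text \<open>
  The leaves are the maximal connected integral manifolds. A leaf is represented by its leaf
  topology, so that equality of foliations includes equality of the immersed submanifold structures
  of the leaves.
\<close>

definition foliation ::
    "'a topology \<Rightarrow> ('a, 'n::finite) chart set \<Rightarrow> ('a, 'n) distribution \<Rightarrow> 'a topology set" where
  "foliation X A \<Delta> =
     (let conn_int = (\<lambda>L. integral_manifold X A \<Delta> L \<and> topspace L \<noteq> {} \<and> connected_space L)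
      in {L. conn_int L \<and> (\<forall>L'. conn_int L' \<and> topspace L \<subseteq> topspace L' \<longrightarrow> L' = L)})"

definition symplectic_foliation ::
    "'a topology \<Rightarrow> ('a, 'n::finite) chart set \<Rightarrow> ('a, 'n, real) bivec_field \<Rightarrow> 'a topology set" where
  "symplectic_foliation X A P = foliation X A (\<lambda>c x. range (sharp (P c x)))"

definition holomorphic_symplectic_leaves ::
    "'a topology \<Rightarrow> ('a, 'n::finite) chart set \<Rightarrow> ('a, 'n, complex) bivec_field \<Rightarrow> 'a topology set" where
  "holomorphic_symplectic_leaves X A \<pi> =
     foliation X A (\<lambda>c x. re_tangent ` csharp (\<pi> c x) ` T10_dual)"

end

theory Submission
  imports Defs
begin

text \<open>
  A foliation is determined by its distribution, so it suffices to compare, at one point of one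
  chart, the images of the maps \<open>\<pi>\<^sub>R\<^sup>\<sharp>\<close>, \<open>\<pi>\<^sub>I\<^sup>\<sharp>\<close> and the real parts of the image of \<open>\<pi>\<^sup>\<sharp>\<close>. This is
  linear algebra for a complex bivector of type (2,0). Write \<open>J\<close> for multiplication by \<open>\<i>\<close> on real
  tangent vectors.

  Since \<open>\<pi>\<close> is a sum of wedge products of vectors of type (1,0), the vector \<open>\<pi>\<^sup>\<sharp>\<alpha>\<close> is again of type
  (1,0), that is, \<open>\<pi>\<^sup>\<sharp>\<alpha> = v - \<i> J v\<close> for a real vector \<open>v\<close> (\<open>csharp_in_T10\<close>). Pairing with real
  covectors and taking real and imaginary parts gives, for real \<open>\<alpha>\<close>,
  \<open>\<pi>\<^sub>R\<^sup>\<sharp>\<alpha> = v\<close> and \<open>\<pi>\<^sub>I\<^sup>\<sharp>\<alpha> = - J v\<close> (\<open>sharp_real_part\<close>, \<open>sharp_imaginary_part\<close>).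

  By antisymmetry \<open>\<pi>\<^sup>\<sharp>\<alpha>\<close> depends only on the restriction of \<open>\<alpha>\<close> to vectors of type (1,0)
  (\<open>csharp_cong_T10\<close>), and taking (1,0)-parts is a bijection from the real covectors to the
  (1,0)-covectors, with inverse \<open>\<gamma> \<mapsto> 2 Re \<gamma>\<close>. Hence the image of \<open>\<pi>\<^sub>R\<^sup>\<sharp>\<close> is the distribution of real
  parts of \<open>\<pi>\<^sup>\<sharp>\<gamma>\<close> with \<open>\<gamma>\<close> of type (1,0). Because \<open>\<pi>\<^sup>\<sharp>\<close> is complex linear, this distribution is
  invariant under \<open>J\<close>, so the image of \<open>\<pi>\<^sub>I\<^sup>\<sharp>\<close> is the same.
\<close>

section \<open>Real and complex covectors\<close>

lemma bounded_linear_scalar_mult: "bounded_linear (\<lambda>v::complex^'n::finite. c *s v)"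
proof -
  have "linear (\<lambda>v::complex^'n. c *s v)"
    by (rule linearI) (simp_all add: vec_eq_iff algebra_simps)
  then show ?thesis
    by (simp add: linear_conv_bounded_linear)
qed

lemma covec_separates:
  fixes v w :: "complex^'n::finite"
  assumes "\<And>\<beta>::('n, real) covec. \<beta> v = \<beta> w"
  shows "v = w"
proof -
  have "blinfun_inner_left (v - w) (v - w) = 0"
    using assms[of "blinfun_inner_left (v - w)"] by (simp only: blinfun.diff_right diff_self)
  then show ?thesis by simp
qed

definition complex_covec :: "('n::finite, real) covec \<Rightarrow> ('n, complex) covec" where
  "complex_covec \<alpha> = Blinfun complex_of_real o\<^sub>L \<alpha>"

lemma complex_covec_apply [simp]: "complex_covec \<alpha> v = complex_of_real (\<alpha> v)"
  by (simp add: complex_covec_def bounded_linear_Blinfun_apply bounded_linear_of_real)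

lemma re_covec_apply [simp]: "re_covec \<alpha> v = Re (\<alpha> v)"
  by (simp add: re_covec_def bounded_linear_Blinfun_apply bounded_linear_Re)

lemma im_covec_apply [simp]: "im_covec \<alpha> v = Im (\<alpha> v)"
  by (simp add: im_covec_def bounded_linear_Blinfun_apply bounded_linear_Im)

lemma re_complex_covec [simp]: "re_covec (complex_covec \<alpha>) = \<alpha>"
  and im_complex_covec [simp]: "im_covec (complex_covec \<alpha>) = 0"
  by (auto intro!: blinfun_eqI)

lemma cpair_separates:
  fixes Z W :: "'n::finite ctangent"
  assumes "\<And>\<beta>. cpair \<beta> Z = cpair \<beta> W"
  shows "Z = W"
proof (rule prod_eqI)
  have eq: "cpair (complex_covec \<beta>) Z = cpair (complex_covec \<beta>) W" for \<beta>
    by (rule assms)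
  show "fst Z = fst W"
    by (rule covec_separates) (use eq in \<open>simp add: cpair_def complex_eq_iff\<close>)
  show "snd Z = snd W"
    by (rule covec_separates) (use eq in \<open>simp add: cpair_def complex_eq_iff\<close>)
qed

section \<open>Contraction with bivectors of type (2,0)\<close>

lemma T10_iff: "Z \<in> T10 \<longleftrightarrow> Z = (fst Z, - (\<i> *s fst Z))"
proof -
  have "\<i> *s (\<i> *s u) = - u" for u :: "complex^'n"
    by (simp add: vec_eq_iff)
  moreover have "\<i> *s (- u) = - (\<i> *s u)" for u :: "complex^'n"
    by (simp add: vec_eq_iff)
  ultimately show ?thesis
    by (cases Z) (auto simp: T10_def)
qed

lemma is_bivec20_antisym:
  assumes "is_bivec20 P"
  shows "P \<beta> \<alpha> = - P \<alpha> \<beta>"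
proof -
  obtain m :: nat and Z W where P: "\<And>\<alpha> \<beta>. P \<alpha> \<beta> = (\<Sum>k<m. wedge (Z k) (W k) \<alpha> \<beta>)"
    using assms unfolding is_bivec20_def by blast
  show ?thesis
    unfolding P sum_negf[symmetric] by (rule sum.cong) (simp_all add: wedge_def)
qed

lemma is_bivec20_scale:
  assumes "is_bivec20 P"
  shows "P (blinfun_mult_right c o\<^sub>L \<alpha>) \<beta> = c * P \<alpha> \<beta>"
proof -
  obtain m :: nat and Z W where P: "\<And>\<alpha> \<beta>. P \<alpha> \<beta> = (\<Sum>k<m. wedge (Z k) (W k) \<alpha> \<beta>)"
    using assms unfolding is_bivec20_def by blast
  show ?thesis
    unfolding P sum_distrib_left
    by (rule sum.cong) (simp_all add: wedge_def cpair_def algebra_simps)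
qed

text \<open>
  The complex multiples of a tangent vector of type (1,0) are obtained by scaling its real part,
  so contracting \<open>\<Sum> Z\<^sub>k \<and> W\<^sub>k\<close> with \<open>\<alpha>\<close> yields the explicit real part
  \<open>\<Sum> \<alpha>(Z\<^sub>k) Re W\<^sub>k - \<alpha>(W\<^sub>k) Re Z\<^sub>k\<close>.
\<close>

lemma is_bivec20_contract:
  fixes P :: "('n::finite, complex) bivec"
  assumes "is_bivec20 P"
  shows "\<exists>Z\<in>T10. \<forall>\<beta>. cpair \<beta> Z = P \<alpha> \<beta>"
proof -
  obtain m :: nat and Z W where
    T10: "\<And>k. k < m \<Longrightarrow> Z k \<in> T10" "\<And>k. k < m \<Longrightarrow> W k \<in> T10" and
    P: "\<And>\<alpha> \<beta>. P \<alpha> \<beta> = (\<Sum>k<m. wedge (Z k) (W k) \<alpha> \<beta>)"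
    using assms unfolding is_bivec20_def by blast
  define extend :: "complex^'n \<Rightarrow> 'n ctangent" where "extend u = (u, - (\<i> *s u))" for u
  define v where
    "v = (\<Sum>k<m. cpair \<alpha> (Z k) *s fst (W k) - cpair \<alpha> (W k) *s fst (Z k))"
  have cpair_extend: "cpair \<beta> (extend u) = \<beta> u - \<i> * \<beta> (\<i> *s u)" for \<beta> u
    by (simp add: extend_def cpair_def blinfun.minus_right)
  have scale: "cpair \<beta> (extend (c *s u)) = c * cpair \<beta> (extend u)" for \<beta> c u
  proof -
    have c_split: "c *s u = Re c *\<^sub>R u + Im c *\<^sub>R (\<i> *s u)"
      by (simp add: vec_eq_iff complex_eq_iff)
    have ic_split: "\<i> *s (c *s u) = Re c *\<^sub>R (\<i> *s u) - Im c *\<^sub>R u"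
      by (simp add: vec_eq_iff complex_eq_iff)
    have "\<beta> (c *s u) = Re c *\<^sub>R \<beta> u + Im c *\<^sub>R \<beta> (\<i> *s u)"
      unfolding c_split by (simp add: blinfun.add_right blinfun.scaleR_right)
    moreover have "\<beta> (\<i> *s (c *s u)) = Re c *\<^sub>R \<beta> (\<i> *s u) - Im c *\<^sub>R \<beta> u"
      unfolding ic_split by (simp add: blinfun.diff_right blinfun.scaleR_right)
    ultimately show ?thesis
      by (simp add: cpair_extend complex_eq_iff algebra_simps)
  qed
  have linear: "linear (\<lambda>u. cpair \<beta> (extend u))" for \<beta>
    unfolding cpair_extend
    by (rule linearI)
      (simp_all add: blinfun.add_right blinfun.scaleR_right algebra_simps
        linear_simps[OF bounded_linear_scalar_mult])
  have Z: "Z k = extend (fst (Z k))" and W: "W k = extend (fst (W k))" if "k < m" for k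
    using T10[OF that] by (auto simp: T10_iff extend_def)
  have "cpair \<beta> (extend v) = P \<alpha> \<beta>" for \<beta>
  proof -
    have "cpair \<beta> (extend v) =
        (\<Sum>k<m. cpair \<alpha> (Z k) * cpair \<beta> (extend (fst (W k)))
          - cpair \<alpha> (W k) * cpair \<beta> (extend (fst (Z k))))"
      unfolding v_def by (simp add: linear_sum[OF linear] linear_diff[OF linear] scale)
    also have "\<dots> = P \<alpha> \<beta>"
      unfolding P wedge_def by (intro sum.cong) (simp_all flip: Z W)
    finally show ?thesis .
  qed
  moreover have "extend v \<in> T10"
    by (simp add: T10_iff extend_def)
  ultimately show ?thesis by blast
qed

lemma csharp_eqI:
  assumes "\<And>\<beta>. cpair \<beta> Z = P \<alpha> \<beta>"
  shows "csharp P \<alpha> = Z"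
  unfolding csharp_def
  by (rule the_equality) (use assms in \<open>auto intro: cpair_separates\<close>)

lemma sharp_eqI:
  assumes "\<And>\<beta>. blinfun_apply \<beta> v = P \<alpha> \<beta>"
  shows "sharp P \<alpha> = v"
  unfolding sharp_def
  by (rule the_equality) (use assms in \<open>auto intro: covec_separates\<close>)

lemma
  assumes "is_bivec20 P"
  shows csharp_in_T10: "csharp P \<alpha> \<in> T10"
    and cpair_csharp: "cpair \<beta> (csharp P \<alpha>) = P \<alpha> \<beta>"
proof -
  obtain Z where Z: "Z \<in> T10" "\<And>\<beta>. cpair \<beta> Z = P \<alpha> \<beta>"
    using is_bivec20_contract[OF assms] by blast
  moreover from Z(2) have "csharp P \<alpha> = Z"
    by (rule csharp_eqI)
  ultimately show "csharp P \<alpha> \<in> T10" "cpair \<beta> (csharp P \<alpha>) = P \<alpha> \<beta>"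
    by simp_all
qed

text \<open>
  By antisymmetry, \<open>P(\<alpha>, \<beta>)\<close> is minus the value of \<open>\<alpha>\<close> on \<open>P\<^sup>\<sharp>\<beta>\<close>, which is of type (1,0).
\<close>

lemma csharp_cong_T10:
  assumes P: "is_bivec20 P" and eq: "\<And>Z. Z \<in> T10 \<Longrightarrow> cpair \<alpha> Z = cpair \<alpha>' Z"
  shows "csharp P \<alpha> = csharp P \<alpha>'"
proof (rule csharp_eqI)
  fix \<beta>
  have "P \<alpha> \<beta> = - cpair \<alpha> (csharp P \<beta>)"
    unfolding cpair_csharp[OF P] by (rule is_bivec20_antisym[OF P])
  also have "\<dots> = - cpair \<alpha>' (csharp P \<beta>)"
    using eq csharp_in_T10[OF P] by simp
  also have "\<dots> = P \<alpha>' \<beta>"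
    unfolding cpair_csharp[OF P] by (rule is_bivec20_antisym[OF P, symmetric])
  finally show "cpair \<beta> (csharp P \<alpha>') = P \<alpha> \<beta>"
    by (simp add: cpair_csharp[OF P])
qed

lemma csharp_neg_i:
  assumes P: "is_bivec20 P"
  shows "re_tangent (csharp P (blinfun_mult_right (- \<i>) o\<^sub>L \<alpha>)) = snd (csharp P \<alpha>)"
proof -
  \<comment> \<open>\<open>-\<i>\<close> times the complex tangent vector \<open>u + \<i> w\<close> is \<open>w - \<i> u\<close>.\<close>
  have "csharp P (blinfun_mult_right (- \<i>) o\<^sub>L \<alpha>) = (snd (csharp P \<alpha>), - fst (csharp P \<alpha>))"
  proof (rule csharp_eqI)
    fix \<beta>
    have "cpair \<beta> (snd (csharp P \<alpha>), - fst (csharp P \<alpha>)) = - \<i> * cpair \<beta> (csharp P \<alpha>)"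
      by (simp add: cpair_def blinfun.minus_right algebra_simps)
    then show "cpair \<beta> (snd (csharp P \<alpha>), - fst (csharp P \<alpha>)) =
        P (blinfun_mult_right (- \<i>) o\<^sub>L \<alpha>) \<beta>"
      by (simp only: cpair_csharp[OF P] is_bivec20_scale[OF P])
  qed
  then show ?thesis
    by (simp add: re_tangent_def)
qed

section \<open>Real covectors and their (1,0)-parts\<close>

text \<open>
  A real covector and its (1,0)-part \<open>v \<mapsto> (\<alpha>(v) - \<i> \<alpha>(J v)) / 2\<close> agree on vectors of type (1,0).
\<close>

lemma real_covec_T10_part:
  fixes \<alpha> :: "('n::finite, real) covec"
  shows "\<exists>\<gamma>\<in>T10_dual. \<forall>Z\<in>T10. cpair (complex_covec \<alpha>) Z = cpair \<gamma> Z"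
proof -
  define J :: "(complex^'n) \<Rightarrow>\<^sub>L (complex^'n)" where "J = Blinfun (\<lambda>v. \<i> *s v)"
  have J: "J v = \<i> *s v" for v
    by (simp add: J_def bounded_linear_Blinfun_apply bounded_linear_scalar_mult)
  define \<gamma> :: "('n, complex) covec" where
    "\<gamma> = (1/2) *\<^sub>R (complex_covec \<alpha> - (blinfun_mult_right \<i> o\<^sub>L complex_covec (\<alpha> o\<^sub>L J)))"
  have \<gamma>: "\<gamma> v = (complex_of_real (\<alpha> v) - \<i> * complex_of_real (\<alpha> (\<i> *s v))) / 2" for v
    by (simp add: \<gamma>_def J blinfun.diff_left blinfun.scaleR_left scaleR_conv_of_real)
  have JJ: "\<i> *s (\<i> *s v) = - v" for v :: "complex^'n"
    by (simp add: vec_eq_iff)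
  have "\<gamma> \<in> T10_dual"
    by (simp add: T10_dual_def \<gamma> JJ blinfun.minus_right field_simps)
  moreover have "cpair (complex_covec \<alpha>) Z = cpair \<gamma> Z" if "Z \<in> T10" for Z
  proof -
    have "snd Z = - (\<i> *s fst Z)" "\<i> *s snd Z = fst Z"
      using that by (auto simp: T10_def)
    then show ?thesis
      by (simp add: cpair_def \<gamma> blinfun.minus_right field_simps)
  qed
  ultimately show ?thesis by blast
qed

text \<open>The factor 2 compensates the factor 1/2 in the (1,0)-part of a real covector.\<close>

lemma T10_dual_real_covec:
  assumes "\<gamma> \<in> T10_dual" "Z \<in> T10"
  shows "cpair (complex_covec (2 *\<^sub>R re_covec \<gamma>)) Z = cpair \<gamma> Z"
proof -
  have "snd Z = - (\<i> *s fst Z)"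
    using assms(2) by (simp add: T10_def case_prod_beta)
  moreover have "\<gamma> (\<i> *s fst Z) = \<i> * \<gamma> (fst Z)"
    using assms(1) by (simp add: T10_dual_def)
  ultimately have "cpair (complex_covec (2 *\<^sub>R re_covec \<gamma>)) Z = 2 * \<gamma> (fst Z)"
    and "cpair \<gamma> Z = 2 * \<gamma> (fst Z)"
    by (simp_all add: cpair_def blinfun.minus_right blinfun.scaleR_left complex_eq_iff)
  then show ?thesis by simp
qed

section \<open>Images of the real and imaginary parts\<close>

text \<open>
  The complex-bilinear extension of a real bivector is real on real covectors. For
  \<open>P = R + \<i> I\<close> and real \<open>\<alpha>\<close> and \<open>\<beta>\<close>, the numbers \<open>R(\<alpha>, \<beta>)\<close> and \<open>I(\<alpha>, \<beta>)\<close> are therefore the real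
  and imaginary parts of \<open>P(\<alpha>, \<beta>)\<close>.
\<close>

lemma complexify_complex_covec:
  assumes "is_bivec R"
  shows "complexify R (complex_covec \<alpha>) (complex_covec \<beta>) = complex_of_real (R \<alpha> \<beta>)"
proof -
  have add: "R (\<alpha> + \<alpha>') \<beta> = R \<alpha> \<beta> + R \<alpha>' \<beta>" and anti: "R \<beta> \<alpha> = - R \<alpha> \<beta>" for \<alpha> \<alpha>' \<beta>
    using assms unfolding is_bivec_def by blast+
  have "R 0 \<beta> = 0" for \<beta>
    using add[of 0 0 \<beta>] by simp
  moreover from this have "R \<alpha> 0 = 0" for \<alpha>
    using anti[of \<alpha> 0] by simp
  ultimately show ?thesis
    by (simp add: complexify_def complex_eq_iff)
qed

lemma
  assumes P: "is_bivec20 P" and "is_bivec R" "is_bivec I"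
    and split: "\<And>\<alpha> \<beta>. P \<alpha> \<beta> = complexify R \<alpha> \<beta> + \<i> * complexify I \<alpha> \<beta>"
  shows sharp_real_part: "sharp R \<alpha> = re_tangent (csharp P (complex_covec \<alpha>))"
    and sharp_imaginary_part: "sharp I \<alpha> = snd (csharp P (complex_covec \<alpha>))"
proof -
  let ?Z = "csharp P (complex_covec \<alpha>)"
  have "complex_of_real (R \<alpha> \<beta>) + \<i> * complex_of_real (I \<alpha> \<beta>) =
      complex_of_real (\<beta> (fst ?Z)) + \<i> * complex_of_real (\<beta> (snd ?Z))" for \<beta>
    using cpair_csharp[OF P, of "complex_covec \<beta>" "complex_covec \<alpha>"]
    by (simp add: split complexify_complex_covec assms cpair_def)
  then have "R \<alpha> \<beta> = \<beta> (fst ?Z)" "I \<alpha> \<beta> = \<beta> (snd ?Z)" for \<beta>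
    by (simp_all add: complex_eq_iff)
  then show "sharp R \<alpha> = re_tangent ?Z" "sharp I \<alpha> = snd ?Z"
    by (simp_all add: sharp_eqI re_tangent_def)
qed

lemma csharp_real_covecs:
  assumes P: "is_bivec20 P"
  shows "range (\<lambda>\<alpha>. csharp P (complex_covec \<alpha>)) = csharp P ` T10_dual"
proof (intro equalityI subsetI)
  fix Z assume "Z \<in> range (\<lambda>\<alpha>. csharp P (complex_covec \<alpha>))"
  then obtain \<alpha> where "Z = csharp P (complex_covec \<alpha>)" by blast
  moreover obtain \<gamma> where "\<gamma> \<in> T10_dual" "\<forall>Z\<in>T10. cpair (complex_covec \<alpha>) Z = cpair \<gamma> Z"
    using real_covec_T10_part by blast
  ultimately show "Z \<in> csharp P ` T10_dual"
    using csharp_cong_T10[OF P, of "complex_covec \<alpha>" \<gamma>] by blast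
next
  fix Z assume "Z \<in> csharp P ` T10_dual"
  then obtain \<gamma> where "\<gamma> \<in> T10_dual" "Z = csharp P \<gamma>" by blast
  then show "Z \<in> range (\<lambda>\<alpha>. csharp P (complex_covec \<alpha>))"
    using csharp_cong_T10[OF P T10_dual_real_covec] by (metis rangeI)
qed

lemma T10_dual_scale:
  assumes "\<gamma> \<in> T10_dual"
  shows "(blinfun_mult_right c o\<^sub>L \<gamma>) \<in> T10_dual"
  using assms by (simp add: T10_dual_def)

text \<open>
  The image is a complex subspace, and the imaginary part of \<open>Z\<close> is the real part of \<open>-\<i> Z\<close>.
\<close>

lemma snd_csharp_T10_dual:
  assumes P: "is_bivec20 P"
  shows "snd ` csharp P ` T10_dual = re_tangent ` csharp P ` T10_dual"
proof (intro equalityI subsetI)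
  fix v assume "v \<in> snd ` csharp P ` T10_dual"
  then show "v \<in> re_tangent ` csharp P ` T10_dual"
    using csharp_neg_i[OF P, symmetric] T10_dual_scale by fastforce
next
  fix v assume "v \<in> re_tangent ` csharp P ` T10_dual"
  then obtain \<gamma> where \<gamma>: "\<gamma> \<in> T10_dual" "v = re_tangent (csharp P \<gamma>)" by blast
  have "blinfun_mult_right (- \<i>) o\<^sub>L (blinfun_mult_right \<i> o\<^sub>L \<gamma>) = \<gamma>"
    by (rule blinfun_eqI) simp
  then have "v = snd (csharp P (blinfun_mult_right \<i> o\<^sub>L \<gamma>))"
    using csharp_neg_i[OF P, of "blinfun_mult_right \<i> o\<^sub>L \<gamma>"] \<gamma>(2) by simp
  then show "v \<in> snd ` csharp P ` T10_dual"
    using T10_dual_scale[OF \<gamma>(1)] by blast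
qed

section \<open>Foliations with the same distribution\<close>

text \<open>
  In the definition of an integral manifold, the tangency condition evaluates \<open>\<Delta> c\<close> only on the
  image of a set \<open>U\<close> contained in the domain of \<open>c\<close>.
\<close>

lemma foliation_cong:
  assumes "\<And>c x. c \<in> A \<Longrightarrow> x \<in> snd c ` fst c \<Longrightarrow> \<Delta> c x = \<Delta>' c x"
  shows "foliation X A \<Delta> = foliation X A \<Delta>'"
proof -
  have imp: "integral_manifold X A \<Delta>2 L"
    if int: "integral_manifold X A \<Delta>1 L"
      and eq: "\<And>c x. c \<in> A \<Longrightarrow> x \<in> snd c ` fst c \<Longrightarrow> \<Delta>1 c x = \<Delta>2 c x" for \<Delta>1 \<Delta>2 L
    unfolding integral_manifold_def
  proof (intro conjI ballI)
    show "topspace L \<subseteq> topspace X" "second_countable L"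
      using int by (auto simp: integral_manifold_def)
    fix p assume "p \<in> topspace L"
    then obtain U c G \<psi> S where *: "p \<in> U" "openin L U" "subtopology L U = subtopology X U"
        "c \<in> A" "U \<subseteq> fst c" "G \<subseteq> snd c ` fst c" "diffeo_on G \<psi>" "subspace S"
        "snd c ` U = {x\<in>G. \<psi> x \<in> S}"
      and tangent: "\<forall>x\<in>snd c ` U. {v. frechet_derivative \<psi> (at x) v \<in> S} = \<Delta>1 c x"
      using int unfolding integral_manifold_def by meson
    have "\<forall>x\<in>snd c ` U. {v. frechet_derivative \<psi> (at x) v \<in> S} = \<Delta>2 c x"
      using tangent eq[OF \<open>c \<in> A\<close>] \<open>U \<subseteq> fst c\<close> by blast
    with * show "\<exists>U. p \<in> U \<and> openin L U \<and> subtopology L U = subtopology X U \<and>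
        (\<exists>c\<in>A. \<exists>G \<psi> S. U \<subseteq> fst c \<and> G \<subseteq> snd c ` fst c \<and> diffeo_on G \<psi> \<and> subspace S \<and>
           snd c ` U = {x\<in>G. \<psi> x \<in> S} \<and>
           (\<forall>x\<in>snd c ` U. {v. frechet_derivative \<psi> (at x) v \<in> S} = \<Delta>2 c x))"
      by blast
  qed
  have "integral_manifold X A \<Delta> = integral_manifold X A \<Delta>'"
    using imp[of \<Delta> _ \<Delta>'] imp[of \<Delta>' _ \<Delta>] assms by (intro ext) metis
  then show ?thesis
    by (simp add: foliation_def)
qed

theorem proposition2p11:
  fixes X :: "'a topology"
    and A :: "('a, 'n::finite) chart set"
    and \<pi> :: "('a, 'n, complex) bivec_field"
    and \<pi>\<^sub>R \<pi>\<^sub>I :: "('a, 'n, real) bivec_field"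
  assumes "complex_manifold X A"
    and "holomorphic_poisson A \<pi>"
    and "bivector_field A \<pi>\<^sub>R"
    and "bivector_field A \<pi>\<^sub>I"
    and "\<And>c x \<alpha> \<beta>. c \<in> A \<Longrightarrow> x \<in> snd c ` fst c \<Longrightarrow>
           \<pi> c x \<alpha> \<beta> = complexify (\<pi>\<^sub>R c x) \<alpha> \<beta> + \<i> * complexify (\<pi>\<^sub>I c x) \<alpha> \<beta>"
  shows "symplectic_foliation X A \<pi>\<^sub>R = symplectic_foliation X A \<pi>\<^sub>I \<and>
         symplectic_foliation X A \<pi>\<^sub>R = holomorphic_symplectic_leaves X A \<pi>"
proof -
  have "range (sharp (\<pi>\<^sub>R c x)) = re_tangent ` csharp (\<pi> c x) ` T10_dual \<and>
      range (sharp (\<pi>\<^sub>I c x)) = re_tangent ` csharp (\<pi> c x) ` T10_dual"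
    if c: "c \<in> A" and x: "x \<in> snd c ` fst c" for c x
  proof -
    have P: "is_bivec20 (\<pi> c x)"
      using assms(2) c x unfolding holomorphic_poisson_def by blast
    have R: "is_bivec (\<pi>\<^sub>R c x)" and I: "is_bivec (\<pi>\<^sub>I c x)"
      using assms(3,4) c x by (simp_all only: bivector_field_def)
    note split = assms(5)[OF c x]
    have "range (sharp (\<pi>\<^sub>R c x)) = re_tangent ` range (\<lambda>\<alpha>. csharp (\<pi> c x) (complex_covec \<alpha>))"
      by (simp add: sharp_real_part[OF P R I split] image_image)
    moreover have "range (sharp (\<pi>\<^sub>I c x)) = snd ` range (\<lambda>\<alpha>. csharp (\<pi> c x) (complex_covec \<alpha>))"
      by (simp add: sharp_imaginary_part[OF P R I split] image_image)
    ultimately show ?thesis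
      by (simp only: csharp_real_covecs[OF P] snd_csharp_T10_dual[OF P])
  qed
  then show ?thesis
    unfolding symplectic_foliation_def holomorphic_symplectic_leaves_def
    by (intro conjI foliation_cong) simp_all
qed

end
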